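(* Let $s$ and $t$ be real numbers with $t-s\neq\pm1$, let $\alpha=\min\{s,t\}$, and for $x\in(-\alpha,\infty)$ define $$z_{s,t}(x)=\begin{cases}\left[\dfrac{\Gamma(x+t)}{\Gamma(x+s)}\right]^{1/(t-s)}-x, & s\neq t,\\[2mm] e^{\psi(x+s)}-x, & s=t.\end{cases}$$ If $|t-s|<1$, then $z_{s,t}$ is convex and decreasing on $(-\alpha,\infty)$. If $|t-s|>1$, then $z_{s,t}$ is concave and increasing on $(-\alpha,\infty)$.
   Context: $\Gamma(x)=\int_0^\infty e^{-\tau}\tau^{x-1}\,d\tau$ for $x>0$ is Euler's gamma function, and $\psi(x)=\frac{d}{dx}\ln\Gamma(x)=\Gamma'(x)/\Gamma(x)$ is the psi (digamma) function. *)

theory Defs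
  imports "HOL-Analysis.Analysis"
begin

text \<open>
  Only the values at x > - min s t matter. There the arguments of \<open>Gamma\<close> and \<open>Digamma\<close> are
  positive, where these agree with Euler's integral (\<open>Gamma_integral_real\<close>) and with the
  logarithmic derivative of the gamma function (\<open>has_field_derivative_ln_Gamma_real\<close>), and the
  base of \<open>powr\<close> is positive.
\<close>

definition gamma_ratio_z :: "real \<Rightarrow> real \<Rightarrow> real \<Rightarrow> real" where
  "gamma_ratio_z s t x =
     (if s = t then exp (Digamma (x + s)) - x
      else (Gamma (x + t) / Gamma (x + s)) powr (1 / (t - s)) - x)"

end

theory Submission
  imports Defs "HOL-Real_Asymp.Real_Asymp"
begin

text \<open>
  Both branches of \<^const>\<open>gamma_ratio_z\<close> become one formula: with \<open>d = \<bar>t - s\<bar>\<close> and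
  \<open>y = x + min s t\<close>, the value at \<open>x\<close> is \<open>exp (g y) - x\<close>, where \<open>g y\<close> is the mean of the digamma
  function over the interval \<open>[y, y + d]\<close>, read as \<open>Digamma y\<close> when \<open>d = 0\<close>
  (\<open>gamma_ratio_z_eq_exp_polygamma_mean\<close>). Up to a translation it remains to study
  \<open>F y = exp (g y) - y\<close> for \<open>y > 0\<close>.

  \<^bold>\<open>Convexity.\<close> Since \<open>F'' = exp g * (g'\<^sup>2 + g'')\<close>, what matters is the sign of \<open>h = g'\<^sup>2 + g''\<close>. The
  functional equation of the polygamma functions makes \<open>h y - h (y + 1)\<close> an elementary positive
  factor times \<open>k y = g' y - (2 * y + d + 1) / (2 * y * (y + d))\<close>, and it makes \<open>k y - k (y + 1)\<close> a
  positive rational function times \<open>1 - d\<^sup>2\<close>. As \<open>k\<close> and \<open>h\<close> tend to 0 along \<open>y, y + 1, y + 2, \<dots>\<close>, a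
  function whose unit steps all go down is nonnegative, so first \<open>k\<close> and then \<open>h\<close> has the sign of
  \<open>1 - d\<^sup>2\<close> (\<open>polygamma_mean_1_bound\<close>, \<open>polygamma_mean_square_plus_derivative_sign\<close>).

  \<^bold>\<open>Monotonicity.\<close> The mean \<open>g (y + n)\<close> lies between two values of the digamma function, so it
  differs from \<open>ln n\<close> by a null sequence and \<open>F (y + n) / n\<close> tends to 0. A convex function with this
  property cannot increase, because the slope of a chord would bound \<open>F (y + n) / n\<close> away from 0
  (\<open>antimono_on_if_convex_on_sublinear\<close>).

  The cases \<open>d < 1\<close> and \<open>d > 1\<close> are mirror images. Both are covered by proving that \<open>\<sigma> * F\<close> is convex
  and decreasing whenever \<open>\<sigma> * (1 - d\<^sup>2) \<ge> 0\<close>, and taking \<open>\<sigma> = 1\<close> or \<open>\<sigma> = -1\<close>.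
\<close>

section \<open>Functions controlled by their unit steps and by their growth\<close>

lemma nonneg_if_unit_steps_down_to_0:
  fixes q :: "real \<Rightarrow> real"
  assumes step: "\<And>y. y > 0 \<Longrightarrow> q (y + 1) \<le> q y"
    and lim: "(\<lambda>n. q (x + real n)) \<longlonglongrightarrow> 0"
    and x: "x > 0"
  shows "0 \<le> q x"
proof -
  have "decseq (\<lambda>n. q (x + real n))"
  proof (rule decseq_SucI)
    fix n show "q (x + real (Suc n)) \<le> q (x + real n)"
      using step[of "x + real n"] x by (simp add: add_ac)
  qed
  from decseq_ge[OF this lim, of 0] show ?thesis by simp
qed

text \<open>
  The slope of the chord from \<open>x\<close> to \<open>y\<close> is at most that of the chord from \<open>x\<close> to \<open>x + n\<close> as soon as
  \<open>x + n\<close> has passed \<open>y\<close>, and the latter slopes tend to 0.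
\<close>

lemma antimono_on_if_convex_on_sublinear:
  fixes f :: "real \<Rightarrow> real"
  assumes f: "convex_on {a<..} f"
    and lim: "\<And>x. x > a \<Longrightarrow> (\<lambda>n. f (x + real n) / real n) \<longlonglongrightarrow> 0"
  shows "antimono_on {a<..} f"
proof (rule monotone_onI)
  fix x y :: real
  assume x: "x \<in> {a<..}" and y: "y \<in> {a<..}" and "x \<le> y"
  show "f y \<le> f x"
  proof (cases "x = y")
    case False
    with \<open>x \<le> y\<close> have xy: "x < y" by simp
    let ?slope = "\<lambda>n. (f (x + real n) - f x) / real n"
    have "(\<lambda>n. f (x + real n) / real n - f x / real n) \<longlonglongrightarrow> 0 - 0"
      using x by (intro tendsto_diff lim lim_const_over_n) auto
    hence "?slope \<longlonglongrightarrow> 0" by (simp add: diff_divide_distrib)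
    moreover have "\<forall>\<^sub>F n in sequentially. (f y - f x) / (y - x) \<le> ?slope n"
      using eventually_gt_at_top[of "nat \<lceil>y - x\<rceil>"]
    proof eventually_elim
      case (elim n)
      hence "y < x + real n" by linarith
      have swap: "(f x - f z) / (x - z) = (f z - f x) / (z - x)" for z
        by (metis minus_diff_eq minus_divide_divide)
      have "(f x - f y) / (x - y) \<le> (f x - f (x + real n)) / (x - (x + real n))"
        using \<open>y < x + real n\<close> x xy by (intro convex_on_slope_le(1)[OF f]) auto
      thus ?case by (simp only: swap[of y] swap[of "x + real n"] add_diff_cancel_left')
    qed
    ultimately have "(f y - f x) / (y - x) \<le> 0"
      by (rule tendsto_lowerbound) simp
    with xy show ?thesis by (simp add: divide_le_0_iff)
  qed simp
qed

lemma convex_on_if_translate_convex_on: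
  fixes f g :: "real \<Rightarrow> real"
  assumes f: "convex_on {0<..} f"
    and g: "\<And>x. x > - a \<Longrightarrow> g x = f (x + a) + c"
  shows "convex_on {- a<..} g"
proof (rule convex_onI)
  fix u x y :: real
  assume u: "0 < u" "u < 1" and xy: "x \<in> {- a<..}" "y \<in> {- a<..}"
  let ?m = "(1 - u) *\<^sub>R x + u *\<^sub>R y"
  have "?m \<in> {- a<..}"
    using u xy by (intro convexD) auto
  hence "g ?m = f (?m + a) + c" by (simp add: g)
  also have "?m + a = (1 - u) *\<^sub>R (x + a) + u *\<^sub>R (y + a)"
    by (simp add: algebra_simps)
  also have "f \<dots> \<le> (1 - u) * f (x + a) + u * f (y + a)"
    using u xy by (intro convex_onD[OF f]) auto
  also have "\<dots> + c = (1 - u) * g x + u * g y"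
    using xy by (simp add: g algebra_simps)
  finally show "g ?m \<le> (1 - u) * g x + u * g y" by simp
qed simp

section \<open>Limits of polygamma functions along unit steps\<close>

text \<open>
  By the functional equation, \<open>Polygamma n (x + m)\<close> is up to sign and factorial the tail after \<open>m\<close>
  terms of the series defining \<open>Polygamma n x\<close>.
\<close>

lemma Polygamma_plus_of_nat_tendsto_0:
  fixes x :: real
  assumes "x > 0" "n > 0"
  shows "(\<lambda>m. Polygamma n (x + real m)) \<longlonglongrightarrow> 0"
proof -
  define s where "s = (-1) ^ Suc n * Polygamma n x / fact n"
  have "(\<lambda>m. \<Sum>k<m. 1 / (x + real k) ^ Suc n) \<longlonglongrightarrow> s"
    using Polygamma_LIMSEQ[of x n] assms by (simp add: sums_def s_def inverse_eq_divide)
  hence "(\<lambda>m. Polygamma n x + (-1) ^ n * fact n * (\<Sum>k<m. 1 / (x + real k) ^ Suc n))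
           \<longlonglongrightarrow> Polygamma n x + (-1) ^ n * fact n * s"
    by (intro tendsto_intros)
  moreover have "Polygamma n x + (-1) ^ n * fact n * s = 0"
    by (simp add: s_def power_add[symmetric] mult_2[symmetric] flip: mult.assoc)
  moreover have "Polygamma n (x + real m) =
      Polygamma n x + (-1) ^ n * fact n * (\<Sum>k<m. 1 / (x + real k) ^ Suc n)" for m
    using assms by (intro Polygamma_plus_of_nat) auto
  ultimately show ?thesis by simp
qed

lemma Digamma_plus_of_nat_asymptotic_ln:
  fixes x :: real
  assumes "x > 0"
  shows "(\<lambda>m. Digamma (x + real m) - ln (real m)) \<longlonglongrightarrow> 0"
proof -
  have "(\<lambda>m. Digamma x - (ln (real m) - (\<Sum>k<m. inverse (x + real k)))) \<longlonglongrightarrow> Digamma x - Digamma x"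
    using Digamma_LIMSEQ[of x] assms by (intro tendsto_intros) auto
  moreover have "Digamma (x + real m) = Digamma x + (\<Sum>k<m. inverse (x + real k))" for m
    using Polygamma_plus_of_nat[of m x 0] assms by (auto simp: inverse_eq_divide)
  ultimately show ?thesis by (simp add: algebra_simps)
qed

section \<open>Means of the derivatives of the logarithm of the gamma function\<close>

text \<open>
  The sequence \<open>ln_Gamma\<close>, \<open>Digamma\<close>, \<open>Polygamma 1\<close>, \<dots>, in which each function is the derivative
  of the one before; \<open>Polygamma n\<close> has index \<open>n + 1\<close>.
\<close>

definition ln_Gamma_deriv :: "nat \<Rightarrow> real \<Rightarrow> real" where
  "ln_Gamma_deriv n = (case n of 0 \<Rightarrow> ln_Gamma | Suc m \<Rightarrow> Polygamma m)"

text \<open>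
  The mean of \<open>Polygamma n\<close> over \<open>[x, x + d]\<close>, with its limit as \<open>d\<close> tends to 0 filled in at
  \<open>d = 0\<close>. Treating the divided difference of the antiderivative as a mean is what lets the cases
  \<open>s = t\<close> and \<open>s \<noteq> t\<close> share one argument.
\<close>

definition polygamma_mean :: "nat \<Rightarrow> real \<Rightarrow> real \<Rightarrow> real" where
  "polygamma_mean n d x =
     (if d = 0 then Polygamma n x
      else (ln_Gamma_deriv n (x + d) - ln_Gamma_deriv n x) / d)"

lemma Polygamma_has_derivative_pos:
  assumes "x > (0 :: real)"
  shows "(Polygamma n has_real_derivative Polygamma (Suc n) x) (at x)"
  using assms by (intro has_field_derivative_Polygamma) (auto elim!: nonpos_Ints_cases)

lemma ln_Gamma_deriv_has_derivative:
  assumes "x > 0"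
  shows "(ln_Gamma_deriv n has_real_derivative Polygamma n x) (at x)"
  using assms
  by (cases n) (simp_all add: ln_Gamma_deriv_def has_field_derivative_ln_Gamma_real
      Polygamma_has_derivative_pos)

lemma polygamma_mean_has_derivative:
  assumes "x > 0" "d \<ge> 0"
  shows "(polygamma_mean n d has_real_derivative polygamma_mean (Suc n) d x) (at x)"
proof (cases "d = 0")
  case True
  thus ?thesis
    using assms by (simp add: polygamma_mean_def[abs_def] Polygamma_has_derivative_pos)
next
  case False
  have "((\<lambda>x. (ln_Gamma_deriv n (x + d) - ln_Gamma_deriv n x) / d) has_real_derivative
      (Polygamma n (x + d) - Polygamma n x) / d) (at x)"
    using assms
    by (intro DERIV_cdivide DERIV_diff ln_Gamma_deriv_has_derivative
        DERIV_shift[THEN iffD1]) auto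
  with False show ?thesis
    by (simp add: polygamma_mean_def[abs_def] ln_Gamma_deriv_def)
qed

text \<open>The mean value theorem, through which asymptotics of polygamma functions pass to their means.\<close>

lemma polygamma_mean_is_value:
  assumes "x > 0" "d \<ge> 0"
  obtains \<xi> where "x \<le> \<xi>" "\<xi> \<le> x + d" "polygamma_mean n d x = Polygamma n \<xi>"
proof (cases "d = 0")
  case True
  with that[of x] show ?thesis by (simp add: polygamma_mean_def)
next
  case False
  with assms have "\<exists>\<xi>>x. \<xi> < x + d \<and>
     ln_Gamma_deriv n (x + d) - ln_Gamma_deriv n x = (x + d - x) * Polygamma n \<xi>"
    by (intro MVT2 ln_Gamma_deriv_has_derivative) auto
  then obtain \<xi> where "x < \<xi>" "\<xi> < x + d"
      "ln_Gamma_deriv n (x + d) - ln_Gamma_deriv n x = d * Polygamma n \<xi>"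
    by auto
  with False that[of \<xi>] show ?thesis by (simp add: polygamma_mean_def)
qed

text \<open>
  The mean lies between the values at the two end points because \<open>Polygamma n\<close> is monotone on the
  positive half line: increasing for even \<open>n\<close>, decreasing for odd \<open>n\<close>. Hence the minimum and maximum
  in the bounds, which cover both directions.
\<close>

lemma polygamma_mean_asymptotic:
  assumes "\<And>y. y > 0 \<Longrightarrow> (\<lambda>m. Polygamma n (y + real m) - c m) \<longlonglongrightarrow> 0"
    and "x > 0" "d \<ge> 0"
  shows "(\<lambda>m. polygamma_mean n d (x + real m) - c m) \<longlonglongrightarrow> 0"
proof -
  let ?P = "\<lambda>y m. Polygamma n (y + real m) - c m"
  have bounds: "min (?P x m) (?P (x + d) m) \<le> polygamma_mean n d (x + real m) - c m"
    "polygamma_mean n d (x + real m) - c m \<le> max (?P x m) (?P (x + d) m)" for m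
  proof -
    obtain \<xi> where \<xi>: "x + real m \<le> \<xi>" "\<xi> \<le> x + d + real m"
        "polygamma_mean n d (x + real m) = Polygamma n \<xi>"
      using polygamma_mean_is_value[of "x + real m" d n] assms by (auto simp: add_ac)
    have anti: "Polygamma n v \<le> Polygamma n u" if "odd n" "0 < u" "u \<le> v" for u v :: real
      using Polygamma_real_strict_antimono[of u v n] that by (cases "u = v") auto
    show "min (?P x m) (?P (x + d) m) \<le> polygamma_mean n d (x + real m) - c m"
      "polygamma_mean n d (x + real m) - c m \<le> max (?P x m) (?P (x + d) m)"
      using Polygamma_real_mono[of "x + real m" \<xi> n] Polygamma_real_mono[of \<xi> "x + d + real m" n]
        anti[of "x + real m" \<xi>] anti[of \<xi> "x + d + real m"] \<xi> assms
      by (cases "even n"; simp add: min_le_iff_disj le_max_iff_disj)+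
  qed
  have "?P x \<longlonglongrightarrow> 0" "?P (x + d) \<longlonglongrightarrow> 0" using assms by auto
  hence "(\<lambda>m. min (?P x m) (?P (x + d) m)) \<longlonglongrightarrow> 0" "(\<lambda>m. max (?P x m) (?P (x + d) m)) \<longlonglongrightarrow> 0"
    using tendsto_min[of "?P x" 0 _ "?P (x + d)" 0] tendsto_max[of "?P x" 0 _ "?P (x + d)" 0]
    by simp_all
  thus ?thesis
    by (rule tendsto_sandwich[rotated 2]) (simp_all only: bounds eventually_True)
qed

lemma polygamma_mean_tendsto_0:
  assumes "x > 0" "d \<ge> 0" "n > 0"
  shows "(\<lambda>m. polygamma_mean n d (x + real m)) \<longlonglongrightarrow> 0"
  using polygamma_mean_asymptotic[of n "\<lambda>_. 0" x d] Polygamma_plus_of_nat_tendsto_0 assms by simp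

lemma polygamma_mean_plus1:
  assumes "x > 0" "d > 0"
  shows "polygamma_mean (Suc n) d (x + 1) = polygamma_mean (Suc n) d x
           + (-1) ^ n * fact n * ((1 / (x + d) ^ Suc n - 1 / x ^ Suc n) / d)"
proof -
  have "Polygamma n (x + d + 1) = Polygamma n (x + d) + (-1) ^ n * fact n / (x + d) ^ Suc n"
    and "Polygamma n (x + 1) = Polygamma n x + (-1) ^ n * fact n / x ^ Suc n"
    using assms by (intro Polygamma_plus1; simp)+
  moreover have "x + 1 + d = x + d + 1" by simp
  ultimately have "polygamma_mean (Suc n) d (x + 1) =
      (Polygamma n (x + d) + (-1) ^ n * fact n / (x + d) ^ Suc n
        - (Polygamma n x + (-1) ^ n * fact n / x ^ Suc n)) / d"
    using assms by (simp only: polygamma_mean_def ln_Gamma_deriv_def nat.case) simp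
  also have "\<dots> = (Polygamma n (x + d) - Polygamma n x) / d
      + (-1) ^ n * fact n * ((1 / (x + d) ^ Suc n - 1 / x ^ Suc n) / d)"
    by (simp only: diff_divide_distrib add_divide_distrib right_diff_distrib
        times_divide_eq_right mult_1_right)
  finally show ?thesis
    using assms by (simp add: polygamma_mean_def ln_Gamma_deriv_def)
qed

text \<open>
  For the two orders that occur in the second derivative, the step of the mean has a form without
  division by \<open>d\<close>, and this form is also correct at \<open>d = 0\<close>.
\<close>

lemma polygamma_mean_1_plus1:
  assumes "x > 0" "d \<ge> 0"
  shows "polygamma_mean 1 d (x + 1) = polygamma_mean 1 d x - 1 / (x * (x + d))"
proof (cases "d = 0")
  case True
  thus ?thesis using assms Polygamma_plus1[of x 1]
    by (simp add: polygamma_mean_def power2_eq_square)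
next
  case False
  with assms have "d > 0" by simp
  moreover from this have "(1 / (x + d) - 1 / x) / d = - (1 / (x * (x + d)))"
    using assms by (simp add: divide_simps)
  ultimately show ?thesis
    using polygamma_mean_plus1[of x d 0] assms by simp
qed

lemma polygamma_mean_2_plus1:
  assumes "x > 0" "d \<ge> 0"
  shows "polygamma_mean 2 d (x + 1) = polygamma_mean 2 d x + (2 * x + d) / (x * (x + d))\<^sup>2"
proof (cases "d = 0")
  case True
  have "2 / x ^ 3 = 2 * x / (x * x)\<^sup>2"
    using assms by (simp add: divide_simps) (simp add: power2_eq_square power3_eq_cube power4_eq_xxxx mult_ac)
  with True show ?thesis using assms Polygamma_plus1[of x 2]
    by (simp add: polygamma_mean_def)
next
  case False
  with assms have "d > 0" by simp
  with polygamma_mean_plus1[of x d 1] assms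
  have "polygamma_mean 2 d (x + 1) = polygamma_mean 2 d x - (1 / (x + d)\<^sup>2 - 1 / x\<^sup>2) / d"
    by (simp add: numeral_2_eq_2 diff_divide_distrib)
  also have "(1 / (x + d)\<^sup>2 - 1 / x\<^sup>2) / d = - ((2 * x + d) / (x * (x + d))\<^sup>2)"
    using assms \<open>d > 0\<close> by (simp add: divide_simps) (simp add: power2_eq_square algebra_simps)
  finally show ?thesis by (simp only: diff_minus_eq_add)
qed

section \<open>The sign of the second derivative\<close>

text \<open>
  The rational function subtracted here is the one that appears when the unit step of
  \<open>g'\<^sup>2 + g''\<close> is factored in the next lemma. It approximates the mean so well that the unit step of the
  difference depends on \<open>d\<close> in its numerator only through \<open>1 - d\<^sup>2\<close>.
\<close>

lemma polygamma_mean_1_bound: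
  assumes d: "d \<ge> 0" and \<sigma>: "\<sigma> * (1 - d\<^sup>2) \<ge> 0" and x: "x > 0"
  shows "0 \<le> \<sigma> * (polygamma_mean 1 d x - (2 * x + d + 1) / (2 * (x * (x + d))))"
    (is "0 \<le> ?k x")
proof (rule nonneg_if_unit_steps_down_to_0[of ?k, OF _ _ x])
  fix y :: real assume y: "y > 0"
  \<comment> \<open>In terms of both end points \<open>y\<close> and \<open>b\<close> the fractions are symmetric, and \<open>p\<close>, \<open>q\<close> are the
    products of the end points before and after the step.\<close>
  define b where "b = y + d"
  have b: "b > 0" "d = b - y" using y d by (auto simp: b_def)
  define p q where "p = y * b" and "q = (y + 1) * (b + 1)"
  have pq: "p > 0" "q > 0" using y b by (simp_all add: p_def q_def)
  have "?k y - ?k (y + 1) = \<sigma> * ((polygamma_mean 1 d y - (y + b + 1) / (2 * p))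
      - ((polygamma_mean 1 d y - 1 / p) - (y + b + 3) / (2 * q)))"
  proof -
    have "2 * y + d + 1 = y + b + 1" "2 * (y + 1) + d + 1 = y + b + 3"
      "y * (y + d) = p" "(y + 1) * (y + 1 + d) = q"
      by (simp_all add: b_def p_def q_def add_ac)
    thus ?thesis
      using polygamma_mean_1_plus1[OF y d] by (simp only: right_diff_distrib)
  qed
  also have "(polygamma_mean 1 d y - (y + b + 1) / (2 * p))
      - ((polygamma_mean 1 d y - 1 / p) - (y + b + 3) / (2 * q))
      = (2 * q - (y + b + 1) * q + (y + b + 3) * p) / (2 * p * q)"
    using pq by (simp add: field_simps)
  also have "2 * q - (y + b + 1) * q + (y + b + 3) * p = 1 - d\<^sup>2"
    unfolding p_def q_def b(2) by (simp add: power2_eq_square algebra_simps)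
  also have "\<sigma> * ((1 - d\<^sup>2) / (2 * p * q)) = (\<sigma> * (1 - d\<^sup>2)) / (2 * p * q)"
    by simp
  also have "\<dots> \<ge> 0" using \<sigma> pq by (intro divide_nonneg_nonneg) auto
  finally show "?k (y + 1) \<le> ?k y" by simp
next
  have "(\<lambda>m. (2 * (x + real m) + d + 1) / (2 * ((x + real m) * (x + real m + d)))) \<longlonglongrightarrow> 0"
    by real_asymp
  with polygamma_mean_tendsto_0[OF x d, of 1]
  have "(\<lambda>m. ?k (x + real m)) \<longlonglongrightarrow> \<sigma> * (0 - 0)"
    by (intro tendsto_intros) auto
  thus "(\<lambda>m. ?k (x + real m)) \<longlonglongrightarrow> 0" by simp
qed

text \<open>
  With \<open>p = y * (y + d)\<close> the step replaces \<open>\<phi>\<close> by \<open>\<phi> - 1 / p\<close>, so that \<open>\<phi>\<^sup>2\<close> cancels and the change is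
  linear in \<open>\<phi>\<close>; the preceding bound gives its sign.
\<close>

lemma polygamma_mean_square_plus_derivative_sign:
  assumes d: "d \<ge> 0" and \<sigma>: "\<sigma> * (1 - d\<^sup>2) \<ge> 0" and x: "x > 0"
  shows "0 \<le> \<sigma> * ((polygamma_mean 1 d x)\<^sup>2 + polygamma_mean 2 d x)"
    (is "0 \<le> ?h x")
proof (rule nonneg_if_unit_steps_down_to_0[of ?h, OF _ _ x])
  fix y :: real assume y: "y > 0"
  define p where "p = y * (y + d)"
  have p: "p > 0" using y d by (simp add: p_def)
  define \<phi> where "\<phi> = polygamma_mean 1 d y"
  have "?h y - ?h (y + 1) = \<sigma> * (\<phi>\<^sup>2 - ((\<phi> - 1 / p)\<^sup>2 + (2 * y + d) / p\<^sup>2))"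
    unfolding polygamma_mean_1_plus1[OF y d] polygamma_mean_2_plus1[OF y d] \<phi>_def p_def
    by (simp add: algebra_simps)
  also have "\<phi>\<^sup>2 - ((\<phi> - 1 / p)\<^sup>2 + (2 * y + d) / p\<^sup>2) = 2 / p * (\<phi> - (2 * y + d + 1) / (2 * p))"
    using p by (simp add: field_simps power2_eq_square)
  also have "\<sigma> * \<dots> = 2 / p * (\<sigma> * (\<phi> - (2 * y + d + 1) / (2 * p)))" by simp
  also have "\<dots> \<ge> 0"
    using polygamma_mean_1_bound[OF d \<sigma> y, folded p_def \<phi>_def] p
    by (intro mult_nonneg_nonneg[of "2 / p"]) simp
  finally show "?h (y + 1) \<le> ?h y" by simp
next
  have "(\<lambda>m. ?h (x + real m)) \<longlonglongrightarrow> \<sigma> * (0\<^sup>2 + 0)"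
    using x d by (intro tendsto_intros polygamma_mean_tendsto_0) auto
  thus "(\<lambda>m. ?h (x + real m)) \<longlonglongrightarrow> 0" by simp
qed

section \<open>Convexity and monotonicity of the gamma ratio function\<close>

text \<open>
  The factor \<open>\<sigma>\<close> stands for the sign of \<open>1 - d\<^sup>2\<close>: the value \<open>-1\<close> turns the concave increasing case
  into a convex decreasing one.
\<close>

lemma exp_polygamma_mean_convex_antimono:
  assumes d: "d \<ge> 0" and \<sigma>: "\<sigma> * (1 - d\<^sup>2) \<ge> 0"
  defines "F \<equiv> \<lambda>x. \<sigma> * (exp (polygamma_mean 0 d x) - x)"
  shows "convex_on {0<..} F" and "antimono_on {0<..} F"
proof -
  let ?g = "polygamma_mean 0 d" and ?\<phi> = "polygamma_mean 1 d" and ?\<phi>' = "polygamma_mean 2 d"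
  have g: "(?g has_real_derivative ?\<phi> x) (at x)"
    and \<phi>: "(?\<phi> has_real_derivative ?\<phi>' x) (at x)" if "x > 0" for x
    using polygamma_mean_has_derivative[OF that d, of 0] polygamma_mean_has_derivative[OF that d, of 1]
    by (simp_all add: numeral_2_eq_2)
  show convex: "convex_on {0<..} F"
  proof (rule f''_ge0_imp_convex)
    fix x :: real assume "x \<in> {0<..}"
    hence x: "x > 0" by simp
    show "(F has_real_derivative \<sigma> * (exp (?g x) * ?\<phi> x - 1)) (at x)"
      unfolding F_def using g[OF x] by (auto intro!: derivative_eq_intros)
    show "((\<lambda>x. \<sigma> * (exp (?g x) * ?\<phi> x - 1)) has_real_derivative
        exp (?g x) * (\<sigma> * ((?\<phi> x)\<^sup>2 + ?\<phi>' x))) (at x)"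
      using g[OF x] \<phi>[OF x]
      by (auto intro!: derivative_eq_intros simp: algebra_simps power2_eq_square)
    show "0 \<le> exp (?g x) * (\<sigma> * ((?\<phi> x)\<^sup>2 + ?\<phi>' x))"
      using polygamma_mean_square_plus_derivative_sign[OF d \<sigma> x] by simp
  qed simp
  show "antimono_on {0<..} F"
  proof (rule antimono_on_if_convex_on_sublinear[OF convex])
    fix x :: real assume x: "x > 0"
    \<comment> \<open>So \<open>exp (?g (x + m))\<close> is asymptotic to \<open>m\<close>, which cancels the linear term.\<close>
    have "(\<lambda>m. ?g (x + real m) - ln (real m)) \<longlonglongrightarrow> 0"
      using x d by (intro polygamma_mean_asymptotic Digamma_plus_of_nat_asymptotic_ln)
    moreover have "(\<lambda>m. (x + real m) / real m) \<longlonglongrightarrow> 1"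
      by real_asymp
    ultimately have "(\<lambda>m. \<sigma> * (exp (?g (x + real m) - ln (real m)) - (x + real m) / real m))
             \<longlonglongrightarrow> \<sigma> * (exp 0 - 1)"
      by (intro tendsto_mult tendsto_diff tendsto_exp tendsto_const)
    moreover have "\<forall>\<^sub>F m in sequentially.
        \<sigma> * (exp (?g (x + real m) - ln (real m)) - (x + real m) / real m) = F (x + real m) / real m"
      using eventually_gt_at_top[of 0]
      by eventually_elim (simp add: F_def exp_diff divide_simps)
    ultimately show "(\<lambda>m. F (x + real m) / real m) \<longlonglongrightarrow> 0"
      using Lim_transform_eventually by fastforce
  qed
qed

lemma gamma_ratio_z_commute: "gamma_ratio_z s t x = gamma_ratio_z t s x"
  if "x + s > 0" "x + t > 0"
proof (cases "s = t")
  case False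
  have eq: "1 / (t - s) = - (1 / (s - t))" using False by (simp add: divide_simps)
  have "(Gamma (x + t) / Gamma (x + s)) powr (1 / (t - s)) =
        (Gamma (x + s) / Gamma (x + t)) powr (1 / (s - t))"
    by (simp only: eq powr_minus_divide) (simp add: powr_divide that less_imp_le)
  with False show ?thesis by (simp add: gamma_ratio_z_def)
qed simp

text \<open>
  The symmetry in \<open>s\<close> and \<open>t\<close> allows the smaller parameter to become the left end point of the
  interval of averaging, so that its length is \<open>\<bar>t - s\<bar>\<close>.
\<close>

lemma gamma_ratio_z_eq_exp_polygamma_mean:
  assumes "x > - min s t"
  shows "gamma_ratio_z s t x = exp (polygamma_mean 0 \<bar>t - s\<bar> (x + min s t)) - x"
proof -
  have ordered: "gamma_ratio_z s t x = exp (polygamma_mean 0 (t - s) (x + s)) - x"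
    if "s \<le> t" "x + s > 0" for s t
    using that
    by (auto simp: gamma_ratio_z_def polygamma_mean_def ln_Gamma_deriv_def powr_def
        ln_Gamma_real_pos ln_div add_ac Gamma_real_pos less_imp_neq[symmetric])
  show ?thesis
    using assms ordered[of s t] ordered[of t s] gamma_ratio_z_commute[of x s t]
    by (cases "s \<le> t") (auto simp: min_def)
qed

theorem theorem1:
  fixes s t \<alpha> :: real
  assumes "t - s \<noteq> 1" and "t - s \<noteq> -1"
    and "\<alpha> = min s t"
  shows "(\<bar>t - s\<bar> < 1 \<longrightarrow>
            convex_on {- \<alpha><..} (gamma_ratio_z s t) \<and>
            antimono_on {- \<alpha><..} (gamma_ratio_z s t)) \<and>
         (\<bar>t - s\<bar> > 1 \<longrightarrow>
            concave_on {- \<alpha><..} (gamma_ratio_z s t) \<and>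
            mono_on {- \<alpha><..} (gamma_ratio_z s t))"
proof -
  define F where "F = (\<lambda>\<sigma> x. \<sigma> * (exp (polygamma_mean 0 \<bar>t - s\<bar> x) - x))"
  have z: "\<sigma> * gamma_ratio_z s t x = F \<sigma> (x + \<alpha>) + \<sigma> * \<alpha>" if "x > - \<alpha>" for \<sigma> x
  proof -
    have "gamma_ratio_z s t x = exp (polygamma_mean 0 \<bar>t - s\<bar> (x + \<alpha>)) - x"
      unfolding assms(3) using that assms(3) by (intro gamma_ratio_z_eq_exp_polygamma_mean) simp
    thus ?thesis by (simp add: F_def right_diff_distrib distrib_left)
  qed
  have shape: "convex_on {- \<alpha><..} (\<lambda>x. \<sigma> * gamma_ratio_z s t x)"
      "antimono_on {- \<alpha><..} (\<lambda>x. \<sigma> * gamma_ratio_z s t x)"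
    if "\<sigma> * (1 - \<bar>t - s\<bar>\<^sup>2) \<ge> 0" for \<sigma>
  proof -
    have F: "convex_on {0<..} (F \<sigma>)" "antimono_on {0<..} (F \<sigma>)"
      using exp_polygamma_mean_convex_antimono[OF _ that] by (simp_all add: F_def)
    show "convex_on {- \<alpha><..} (\<lambda>x. \<sigma> * gamma_ratio_z s t x)"
      by (rule convex_on_if_translate_convex_on[OF F(1) z])
    show "antimono_on {- \<alpha><..} (\<lambda>x. \<sigma> * gamma_ratio_z s t x)"
      using monotone_onD[OF F(2)] by (intro monotone_onI) (auto simp: z)
  qed
  show ?thesis
  proof (intro conjI impI)
    assume "\<bar>t - s\<bar> < 1"
    hence "1 * (1 - \<bar>t - s\<bar>\<^sup>2) \<ge> 0" by (simp add: abs_square_le_1 del: power2_abs)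
    from shape[OF this] show "convex_on {- \<alpha><..} (gamma_ratio_z s t)"
      and "antimono_on {- \<alpha><..} (gamma_ratio_z s t)" by simp_all
  next
    assume "\<bar>t - s\<bar> > 1"
    hence "-1 * (1 - \<bar>t - s\<bar>\<^sup>2) \<ge> 0" using one_le_power[of "\<bar>t - s\<bar>" 2] by simp
    from shape[OF this] show "concave_on {- \<alpha><..} (gamma_ratio_z s t)"
      and "mono_on {- \<alpha><..} (gamma_ratio_z s t)"
      by (simp_all add: concave_on_def monotone_on_def)
  qed
qed

end
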